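(* Let $\mathcal{M}$ be a von Neumann algebra with predual $\mathcal{M}_*$. Then $x \in \mathcal{M}$ is invertible in $\mathcal{M}$ if and only if there exist a unitary $u \in \mathcal{M}$ and an $\epsilon > 0$ such that $f(x) \geq \epsilon$ for all $f \in S^u$, where $S^u = \{f \in \mathcal{M}_* : f(u) = \|f\| = 1\}$.
   Context: $\mathcal{M}_*$ denotes the predual of $\mathcal{M}$, identified with the Banach space of weak*-continuous (normal) complex-linear functionals on $\mathcal{M}$. The condition $f(x) \geq \epsilon$ means that the complex number $f(x)$ is real and at least $\epsilon$. *)

theory Defs
  imports "HOL-Analysis.Analysis"
begin

subsection \<open>Complex Hilbert spaces\<close>

text \<open>The inner product is linear in its first argument. Positive definiteness is part of the
  axiom \<open>cinner_self\<close>, since the norm is definite.\<close>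

class complex_inner = real_normed_vector +
  fixes scaleC :: "complex \<Rightarrow> 'a \<Rightarrow> 'a" (infixr "*\<^sub>C" 75)
    and cinner :: "'a \<Rightarrow> 'a \<Rightarrow> complex"
  assumes scaleC_add_right: "a *\<^sub>C (x + y) = a *\<^sub>C x + a *\<^sub>C y"
    and scaleC_add_left: "(a + b) *\<^sub>C x = a *\<^sub>C x + b *\<^sub>C x"
    and scaleC_scaleC: "a *\<^sub>C b *\<^sub>C x = (a * b) *\<^sub>C x"
    and scaleR_scaleC: "r *\<^sub>R x = complex_of_real r *\<^sub>C x"
    and cinner_commute: "cinner x y = cnj (cinner y x)"
    and cinner_add_left: "cinner (x + y) z = cinner x z + cinner y z"
    and cinner_scaleC_left: "cinner (a *\<^sub>C x) y = a * cinner x y"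
    and cinner_self: "cinner x x = complex_of_real ((norm x)\<^sup>2)"

class chilbert_space = complex_inner + banach

lemma cinner_add_right: "cinner x (y + z) = cinner x y + cinner (x::'a::complex_inner) z"
  by (metis cinner_add_left cinner_commute complex_cnj_add)

lemma cinner_scaleC_right: "cinner x (a *\<^sub>C y) = cnj a * cinner (x::'a::complex_inner) y"
  by (metis cinner_commute cinner_scaleC_left complex_cnj_mult)

lemma scaleC_minus1: "(-1) *\<^sub>C x = - (x::'a::complex_inner)"
  using scaleR_scaleC[of "-1" x] by simp

lemma cinner_minus_left: "cinner (- x) y = - cinner (x::'a::complex_inner) y"
  by (metis cinner_scaleC_left mult_minus1 scaleC_minus1)

lemma cinner_diff_left: "cinner (x - y) z = cinner x z - cinner (y::'a::complex_inner) z"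
  using cinner_add_left[of x "- y" z] by (simp add: cinner_minus_left)

lemma cinner_diff_right: "cinner z (x - y) = cinner z x - cinner z (y::'a::complex_inner)"
  by (metis cinner_commute cinner_diff_left complex_cnj_diff)

lemma norm_add_sq:
  "(norm (x + y))\<^sup>2 = (norm x)\<^sup>2 + 2 * Re (cinner x y) + (norm (y::'a::complex_inner))\<^sup>2"
proof -
  have "complex_of_real ((norm (x + y))\<^sup>2) = cinner x x + cinner x y + cinner y x + cinner y y"
    by (simp only: cinner_self[symmetric] cinner_add_left cinner_add_right add_ac)
  then have "(norm (x + y))\<^sup>2 = Re (cinner x x + cinner x y + cinner y x + cinner y y)"
    by (metis Re_complex_of_real)
  moreover have "Re (cinner y x) = Re (cinner x y)"
    by (subst cinner_commute) simp
  ultimately show ?thesis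
    by (simp add: cinner_self)
qed

lemma norm_scaleC: "norm (a *\<^sub>C x) = cmod a * norm (x::'a::complex_inner)"
proof -
  have "complex_of_real ((norm (a *\<^sub>C x))\<^sup>2) = (a * cnj a) * complex_of_real ((norm x)\<^sup>2)"
    by (simp only: cinner_self[symmetric] cinner_scaleC_left cinner_scaleC_right mult_ac)
  also have "\<dots> = complex_of_real ((cmod a * norm x)\<^sup>2)"
    by (simp add: complex_norm_square[symmetric] power_mult_distrib)
  finally have "(norm (a *\<^sub>C x))\<^sup>2 = (cmod a * norm x)\<^sup>2"
    using of_real_eq_iff by blast
  then show ?thesis
    by (simp add: power2_eq_iff_nonneg)
qed

lemma parallelogram:
  "(norm (x + y))\<^sup>2 + (norm (x - y))\<^sup>2 = 2 * (norm x)\<^sup>2 + 2 * (norm (y::'a::complex_inner))\<^sup>2"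
proof -
  have "cinner x (- y) = - cinner x y"
    using cinner_diff_right[of x 0 y] cinner_diff_right[of x 0 0] by simp
  then show ?thesis
    using norm_add_sq[of x y] norm_add_sq[of x "- y"] by simp
qed

lemma cmod_cinner_le: "cmod (cinner x y) \<le> norm x * norm (y::'a::complex_inner)"
proof (cases "y = 0")
  case True
  then show ?thesis
    using cinner_diff_right[of x 0 0] by simp
next
  case False
  define c where "c = cinner x y"
  define N where "N = (norm y)\<^sup>2"
  have N: "N > 0" using False by (simp add: N_def)
  have "0 \<le> (norm (x + (- c / of_real N) *\<^sub>C y))\<^sup>2" by simp
  also have "\<dots> = (norm x)\<^sup>2 - 2 * (cmod c)\<^sup>2 / N + (cmod c)\<^sup>2 / N"
  proof -
    have "cnj c * c = complex_of_real ((cmod c)\<^sup>2)"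
      by (metis complex_norm_square mult.commute)
    then have "cinner x ((- c / of_real N) *\<^sub>C y) = complex_of_real (- (cmod c)\<^sup>2 / N)"
      by (simp add: cinner_scaleC_right flip: c_def)
    then have "Re (cinner x ((- c / of_real N) *\<^sub>C y)) = - (cmod c)\<^sup>2 / N"
      by (metis Re_complex_of_real)
    moreover have "(norm ((- c / of_real N) *\<^sub>C y))\<^sup>2 = (cmod c)\<^sup>2 / N"
      using N by (simp add: norm_scaleC norm_divide power_mult_distrib power_divide
          power2_eq_square[of N] flip: N_def)
    ultimately show ?thesis
      by (simp add: norm_add_sq)
  qed
  finally have "(cmod c)\<^sup>2 \<le> (norm x)\<^sup>2 * N"
    using N by (simp add: field_simps)
  then have "(cmod c)\<^sup>2 \<le> (norm x * norm y)\<^sup>2"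
    by (simp add: N_def power_mult_distrib)
  then show ?thesis
    unfolding c_def by (rule power2_le_imp_le) simp
qed

lemma riesz_representation:
  fixes \<phi> :: "'a::chilbert_space \<Rightarrow> complex"
  assumes bl: "bounded_linear \<phi>" and hom: "\<And>c x. \<phi> (c *\<^sub>C x) = c * \<phi> x"
  shows "\<exists>z. \<forall>x. \<phi> x = cinner x z"
proof (cases "\<forall>x. \<phi> x = 0")
  case True
  have "cinner x 0 = 0" for x :: 'a
    using cinner_diff_right[of x 0 0] by simp
  with True show ?thesis by metis
next
  case False
  interpret \<phi>: bounded_linear \<phi> by (rule bl)
  from False obtain p where "\<phi> p \<noteq> 0" by blast
  define A where "A = {x. \<phi> x = 1}"
  have pA: "(1 / \<phi> p) *\<^sub>C p \<in> A"
    using \<open>\<phi> p \<noteq> 0\<close> by (simp add: A_def hom)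
  define D where "D = (INF x\<in>A. (norm x)\<^sup>2)"
  have bdd: "bdd_below ((\<lambda>x. (norm x)\<^sup>2) ` A)"
    by (rule bdd_belowI[of _ 0]) auto
  have D_le: "D \<le> (norm x)\<^sup>2" if "x \<in> A" for x
    unfolding D_def using bdd that by (rule cINF_lower)
  define S where "S n = A \<inter> {x. (norm x)\<^sup>2 \<le> D + 1 / real (Suc n)}" for n
  have "closed (S n)" for n
  proof -
    have "closed A"
      unfolding A_def by (intro closed_Collect_eq continuous_intros \<phi>.continuous_on)
    moreover have "closed {x::'a. (norm x)\<^sup>2 \<le> D + 1 / real (Suc n)}"
      by (intro closed_Collect_le continuous_intros)
    ultimately show ?thesis
      unfolding S_def by (rule closed_Int)
  qed
  moreover have "S n \<noteq> {}" for n
  proof -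
    have "D < D + 1 / real (Suc n)" by simp
    then obtain x where "x \<in> A" "(norm x)\<^sup>2 < D + 1 / real (Suc n)"
      using pA cINF_less_iff[OF _ bdd] unfolding D_def[symmetric] by blast
    then show ?thesis
      by (auto simp: S_def intro!: less_imp_le)
  qed
  moreover have "S n \<subseteq> S m" if "m \<le> n" for m n
  proof -
    have "1 / real (Suc n) \<le> 1 / real (Suc m)"
      using that by (simp add: frac_le)
    then show ?thesis unfolding S_def by auto
  qed
  moreover have "\<exists>n. \<forall>x\<in>S n. \<forall>y\<in>S n. dist x y < e" if "e > 0" for e
  proof -
    obtain n where n: "1 / real (Suc n) < e\<^sup>2 / 4"
      using reals_Archimedean[of "e\<^sup>2 / 4"] \<open>e > 0\<close> by (auto simp: inverse_eq_divide)
    have "dist x y < e" if "x \<in> S n" "y \<in> S n" for x y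
    proof -
      have "(1/2) *\<^sub>R (x + y) \<in> A"
        using that by (simp add: S_def A_def \<phi>.scaleR \<phi>.add scaleR_conv_of_real)
      from D_le[OF this] have "4 * D \<le> (norm (x + y))\<^sup>2"
        by (simp add: power_mult_distrib power2_eq_square)
      moreover have "(norm x)\<^sup>2 \<le> D + 1 / real (Suc n)" "(norm y)\<^sup>2 \<le> D + 1 / real (Suc n)"
        using that by (auto simp: S_def)
      ultimately have "(norm (x - y))\<^sup>2 < e\<^sup>2"
        using parallelogram[of x y] n by linarith
      then show ?thesis
        using \<open>e > 0\<close> by (simp add: dist_norm power2_less_imp_less)
    qed
    then show ?thesis by blast
  qed
  ultimately obtain a where a: "\<And>n. a \<in> S n"
    using decreasing_closed_nest[of S] by metis
  have aA: "\<phi> a = 1"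
    using a[of 0] by (simp add: S_def A_def)
  have "(norm a)\<^sup>2 \<le> D"
  proof (rule field_le_epsilon)
    fix e :: real assume "e > 0"
    then obtain n where "1 / real (Suc n) < e"
      using reals_Archimedean[of e] by (auto simp: inverse_eq_divide)
    then show "(norm a)\<^sup>2 \<le> D + e"
      using a[of n] by (simp add: S_def)
  qed
  then have a_min: "(norm a)\<^sup>2 \<le> (norm x)\<^sup>2" if "\<phi> x = 1" for x
  proof -
    note \<open>(norm a)\<^sup>2 \<le> D\<close>
    also have "D \<le> (norm x)\<^sup>2" using that by (intro D_le) (simp add: A_def)
    finally show ?thesis .
  qed
  have orth: "cinner w a = 0" if "\<phi> w = 0" for w
  proof -
    define c where "c = cinner w a"
    define t where "t = 1 / ((norm w)\<^sup>2 + 1)"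
    have "(norm w)\<^sup>2 + 1 > 0" by (simp add: add_nonneg_pos)
    then have t: "t > 0" "t * (norm w)\<^sup>2 \<le> 1"
      unfolding t_def by (auto simp: field_simps)
    define s where "s = - (of_real t * cnj c)"
    have "(norm a)\<^sup>2 \<le> (norm (s *\<^sub>C w + a))\<^sup>2"
      by (rule a_min) (simp add: \<phi>.add hom that aA)
    then have "0 \<le> (norm (s *\<^sub>C w))\<^sup>2 + 2 * Re (cinner (s *\<^sub>C w) a)"
      by (simp add: norm_add_sq)
    moreover have "(norm (s *\<^sub>C w))\<^sup>2 = t * (cmod c)\<^sup>2 * (t * (norm w)\<^sup>2)"
      using t by (simp add: s_def norm_scaleC norm_mult power_mult_distrib power2_eq_square)
    moreover have "Re (cinner (s *\<^sub>C w) a) = - t * (cmod c)\<^sup>2"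
    proof -
      have "cnj c * c = complex_of_real ((cmod c)\<^sup>2)"
        by (metis complex_norm_square mult.commute)
      then have "cinner (s *\<^sub>C w) a = complex_of_real (- t * (cmod c)\<^sup>2)"
        by (simp add: cinner_scaleC_left s_def mult.assoc flip: c_def)
      then show ?thesis by (metis Re_complex_of_real)
    qed
    moreover have "t * (cmod c)\<^sup>2 * (t * (norm w)\<^sup>2) \<le> t * (cmod c)\<^sup>2 * 1"
      using t by (intro mult_left_mono) auto
    ultimately have "t * (cmod c)\<^sup>2 \<le> 0" by linarith
    then have "(cmod c)\<^sup>2 \<le> 0"
      using t by (simp add: mult_le_0_iff)
    then show ?thesis by (simp add: c_def)
  qed
  have "a \<noteq> 0" using aA \<phi>.zero by auto
  have "\<phi> x = cinner x ((1 / complex_of_real ((norm a)\<^sup>2)) *\<^sub>C a)" for x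
  proof -
    have "\<phi> (x - \<phi> x *\<^sub>C a) = 0"
      by (simp add: \<phi>.diff hom aA)
    from orth[OF this] have "cinner x a = \<phi> x * complex_of_real ((norm a)\<^sup>2)"
      by (simp add: cinner_diff_left cinner_scaleC_left cinner_self)
    then show ?thesis
      using \<open>a \<noteq> 0\<close> by (simp add: cinner_scaleC_right)
  qed
  then show ?thesis by blast
qed


subsection \<open>Bounded complex-linear operators\<close>

definition complex_ops :: "('a::complex_inner \<Rightarrow>\<^sub>L 'a) set" where
  "complex_ops = {T. \<forall>c x. blinfun_apply T (c *\<^sub>C x) = c *\<^sub>C blinfun_apply T x}"

lift_definition scaleC_op :: "complex \<Rightarrow> ('a::complex_inner \<Rightarrow>\<^sub>L 'a) \<Rightarrow> 'a \<Rightarrow>\<^sub>L 'a"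
  is "\<lambda>c T x. c *\<^sub>C T x"
proof -
  fix c :: complex and T :: "'a \<Rightarrow> 'a"
  assume "bounded_linear T"
  moreover have "bounded_linear (\<lambda>x::'a. c *\<^sub>C x)"
    by (rule bounded_linear_intro[where K = "cmod c"])
      (simp_all add: scaleC_add_right scaleR_scaleC scaleC_scaleC mult.commute norm_scaleC)
  ultimately show "bounded_linear (\<lambda>x. c *\<^sub>C T x)"
    by (rule bounded_linear_compose[rotated])
qed

definition is_adjoint :: "('a::complex_inner \<Rightarrow>\<^sub>L 'a) \<Rightarrow> ('a \<Rightarrow>\<^sub>L 'a) \<Rightarrow> bool" where
  "is_adjoint T S \<longleftrightarrow> (\<forall>x y. cinner (T x) y = cinner x (S y))"

definition adj :: "('a::complex_inner \<Rightarrow>\<^sub>L 'a) \<Rightarrow> 'a \<Rightarrow>\<^sub>L 'a" where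
  "adj T = (THE S. is_adjoint T S)"

lemma cinner_right_eqI:
  assumes "\<And>x. cinner x y = cinner x (z::'a::complex_inner)"
  shows "y = z"
  using cinner_self[of "y - z"] assms by (simp add: cinner_diff_right)

lemma is_adjoint_unique: "is_adjoint T S \<Longrightarrow> is_adjoint T S' \<Longrightarrow> S = S'"
  unfolding is_adjoint_def by (metis blinfun_eqI cinner_right_eqI)

lemma adj_eqI: "is_adjoint T S \<Longrightarrow> adj T = S"
  unfolding adj_def using is_adjoint_unique by blast

lemma is_adjoint_adj:
  fixes T :: "'a::chilbert_space \<Rightarrow>\<^sub>L 'a"
  assumes T: "T \<in> complex_ops"
  shows "is_adjoint T (adj T)"
proof -
  have "\<exists>z. \<forall>x. cinner (T x) y = cinner x z" for y
  proof (rule riesz_representation)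
    show "bounded_linear (\<lambda>x. cinner (T x) y)"
    proof (rule bounded_linear_intro[where K = "norm T * norm y"])
      show "norm (cinner (T x) y) \<le> norm x * (norm T * norm y)" for x
      proof -
        have "cmod (cinner (T x) y) \<le> norm (T x) * norm y" by (rule cmod_cinner_le)
        also have "\<dots> \<le> (norm T * norm x) * norm y"
          by (intro mult_right_mono norm_blinfun) simp
        finally show ?thesis by (simp add: mult_ac)
      qed
      show "cinner (T (r *\<^sub>R x)) y = r *\<^sub>R cinner (T x) y" for r x
        unfolding blinfun.scaleR_right scaleR_scaleC[of r "T x"] cinner_scaleC_left scaleR_conv_of_real ..
    qed (simp add: blinfun.add_right cinner_add_left)
    show "cinner (T (c *\<^sub>C x)) y = c * cinner (T x) y" for c x
      using T by (simp add: complex_ops_def cinner_scaleC_left)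
  qed
  then obtain s where s: "\<And>x y. cinner (T x) y = cinner x (s y)" by metis
  have "bounded_linear s"
  proof (rule bounded_linear_intro[where K = "norm T"])
    show "s (x + y) = s x + s y" for x y
      by (rule cinner_right_eqI) (simp add: cinner_add_right flip: s)
    show "s (r *\<^sub>R x) = r *\<^sub>R s x" for r x
      by (rule cinner_right_eqI) (simp add: scaleR_scaleC cinner_scaleC_right flip: s)
    show "norm (s y) \<le> norm y * norm T" for y
    proof -
      have "(norm (s y))\<^sup>2 = cmod (cinner (s y) (s y))"
        by (simp add: cinner_self norm_power)
      also have "\<dots> = cmod (cinner (T (s y)) y)" by (simp add: s)
      also have "\<dots> \<le> norm (T (s y)) * norm y" by (rule cmod_cinner_le)
      also have "\<dots> \<le> (norm T * norm (s y)) * norm y"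
        by (intro mult_right_mono norm_blinfun) simp
      finally have "norm (s y) * norm (s y) \<le> (norm y * norm T) * norm (s y)"
        by (simp add: power2_eq_square mult_ac)
      then show ?thesis
        by (cases "s y = 0") (auto simp: mult_le_cancel_right)
    qed
  qed
  then have "is_adjoint T (Blinfun s)"
    by (simp add: is_adjoint_def s bounded_linear_Blinfun_apply)
  then show ?thesis
    using adj_eqI by metis
qed


subsection \<open>Von Neumann algebras and their preduals\<close>

text \<open>A von Neumann algebra is a unital *-subalgebra of the bounded operators on a complex Hilbert
  space which is closed in the strong operator topology. The complex-linear operators form a closed
  subset of the real-linear ones in this topology, so it does not matter in which of the two spaces
  closedness is required.\<close>

definition von_neumann_algebra :: "('a::chilbert_space \<Rightarrow>\<^sub>L 'a) set \<Rightarrow> bool" where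
  "von_neumann_algebra M \<longleftrightarrow>
     M \<subseteq> complex_ops \<and>
     id_blinfun \<in> M \<and>
     (\<forall>S\<in>M. \<forall>T\<in>M. S + T \<in> M) \<and>
     (\<forall>c. \<forall>T\<in>M. scaleC_op c T \<in> M) \<and>
     (\<forall>S\<in>M. \<forall>T\<in>M. S o\<^sub>L T \<in> M) \<and>
     (\<forall>T\<in>M. adj T \<in> M) \<and>
     closedin strong_operator_topology M"

definition invertible_in :: "('a::chilbert_space \<Rightarrow>\<^sub>L 'a) set \<Rightarrow> ('a \<Rightarrow>\<^sub>L 'a) \<Rightarrow> bool" where
  "invertible_in M x \<longleftrightarrow> (\<exists>y\<in>M. x o\<^sub>L y = id_blinfun \<and> y o\<^sub>L x = id_blinfun)"

definition unitary_op :: "('a::chilbert_space \<Rightarrow>\<^sub>L 'a) \<Rightarrow> bool" where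
  "unitary_op u \<longleftrightarrow> adj u o\<^sub>L u = id_blinfun \<and> u o\<^sub>L adj u = id_blinfun"

text \<open>The weak* topology of a von Neumann algebra is the restriction of the ultraweak topology: the
  coarsest one for which all functionals \<open>T \<mapsto> \<Sum>n. \<langle>T \<xi>\<^sub>n, \<eta>\<^sub>n\<rangle>\<close> with square-summable
  \<open>\<xi>\<close>, \<open>\<eta>\<close> are continuous.\<close>

definition ultraweak_topology :: "('a::chilbert_space \<Rightarrow>\<^sub>L 'a) topology" where
  "ultraweak_topology = topology_generated_by
     {{T. (\<Sum>n. cinner (blinfun_apply T (\<xi> n)) (\<eta> n)) \<in> U} |\<xi> \<eta> U.
        summable (\<lambda>n::nat. (norm (\<xi> n))\<^sup>2) \<and> summable (\<lambda>n. (norm (\<eta> n))\<^sup>2) \<and> open U}"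

text \<open>Extensionality makes each functional on \<open>M\<close> correspond to exactly one function on the
  surrounding type.\<close>

definition predual :: "('a::chilbert_space \<Rightarrow>\<^sub>L 'a) set \<Rightarrow> (('a \<Rightarrow>\<^sub>L 'a) \<Rightarrow> complex) set" where
  "predual M = {f \<in> extensional M.
     (\<forall>S\<in>M. \<forall>T\<in>M. f (S + T) = f S + f T) \<and>
     (\<forall>c. \<forall>T\<in>M. f (scaleC_op c T) = c * f T) \<and>
     continuous_map (subtopology ultraweak_topology M) euclidean f}"

definition functional_norm ::
    "('a::chilbert_space \<Rightarrow>\<^sub>L 'a) set \<Rightarrow> (('a \<Rightarrow>\<^sub>L 'a) \<Rightarrow> complex) \<Rightarrow> real" where
  "functional_norm M f = (SUP T\<in>{T\<in>M. norm T \<le> 1}. cmod (f T))"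

definition normal_states_at ::
    "('a::chilbert_space \<Rightarrow>\<^sub>L 'a) set \<Rightarrow> ('a \<Rightarrow>\<^sub>L 'a) \<Rightarrow> (('a \<Rightarrow>\<^sub>L 'a) \<Rightarrow> complex) set" where
  "normal_states_at M u =
     {f \<in> predual M. f u = complex_of_real (functional_norm M f) \<and> functional_norm M f = 1}"

end

theory Submission
  imports Defs
begin

text \<open>If \<open>x\<close> is invertible with polar decomposition \<open>x = u |x|\<close>, then a functional attaining its norm
  at \<open>u\<close> sends \<open>u s\<close> to a real number for every self-adjoint \<open>s\<close>, and the lower bound
  comes from \<open>|x|\<close> being bounded below. Conversely, \<open>T \<mapsto> \<langle>T \<xi>, u \<xi>\<rangle>\<close> belongs to \<open>S\<^sup>u\<close> for every
  unit vector \<open>\<xi>\<close>, so the hypothesis makes \<open>h = u\<^sup>* x\<close> coercive. In both directions the point is that a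
  coercive \<open>h\<close> satisfies \<open>\<parallel>1 - t h\<parallel> < 1\<close> for some \<open>t > 0\<close>; then the inverse of \<open>t h\<close> and, for
  self-adjoint \<open>h\<close>, its square root arise as fixed points of contractions of the norm-closed
  algebra \<open>M\<close>.\<close>

subsection \<open>Operators on a complex Hilbert space\<close>

lemmas compose_simps =
  bounded_bilinear.add_left[OF bounded_bilinear_blinfun_compose]
  bounded_bilinear.add_right[OF bounded_bilinear_blinfun_compose]
  bounded_bilinear.diff_left[OF bounded_bilinear_blinfun_compose]
  bounded_bilinear.diff_right[OF bounded_bilinear_blinfun_compose]
  bounded_bilinear.scaleR_left[OF bounded_bilinear_blinfun_compose]
  bounded_bilinear.scaleR_right[OF bounded_bilinear_blinfun_compose]

lemma blinfun_compose_id [simp]: "T o\<^sub>L id_blinfun = T" "id_blinfun o\<^sub>L T = T"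
  by (auto intro: blinfun_eqI)

lemma blinfun_compose_assoc: "(R o\<^sub>L S) o\<^sub>L T = R o\<^sub>L (S o\<^sub>L T)"
  by (rule blinfun_eqI) simp

lemma scaleC_op_of_real: "scaleC_op (of_real r) T = r *\<^sub>R T"
  by (rule blinfun_eqI) (simp add: scaleC_op.rep_eq scaleR_blinfun.rep_eq scaleR_scaleC)

lemma cinner_scaleR_left: "cinner (r *\<^sub>R x) y = of_real r * cinner (x::'a::complex_inner) y"
  by (simp add: scaleR_scaleC cinner_scaleC_left)

lemma cinner_scaleR_right: "cinner x (r *\<^sub>R y) = of_real r * cinner (x::'a::complex_inner) y"
  by (simp add: scaleR_scaleC cinner_scaleC_right)

lemma bounded_linear_cinner_left: "bounded_linear (\<lambda>x. cinner x (y::'a::complex_inner))"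
  by (rule bounded_linear_intro[where K = "norm y"])
    (simp_all add: cinner_add_left cinner_scaleR_left scaleR_conv_of_real cmod_cinner_le)

lemma bounded_linear_cinner_right: "bounded_linear (\<lambda>y. cinner (x::'a::complex_inner) y)"
  by (rule bounded_linear_intro[where K = "norm x"])
    (simp_all add: cinner_add_right cinner_scaleR_right scaleR_conv_of_real mult.commute[of _ "norm x"]
      cmod_cinner_le)

text \<open>For fixed vectors, both sides of the defining identity are norm-continuous in
  \<open>T\<close>. Closedness makes the domain of the square-root iteration complete.\<close>

lemma closed_selfadjoint: "closed {T::'a::complex_inner \<Rightarrow>\<^sub>L 'a. is_adjoint T T}"
proof -
  have "continuous_on UNIV (\<lambda>T::'a \<Rightarrow>\<^sub>L 'a. cinner (T x) y)"
    "continuous_on UNIV (\<lambda>T::'a \<Rightarrow>\<^sub>L 'a. cinner x (T y))" for x y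
    by (intro bounded_linear.continuous_on[OF bounded_linear_cinner_left]
        bounded_linear.continuous_on[OF bounded_linear_cinner_right] continuous_intros)+
  then show ?thesis
    unfolding is_adjoint_def by (intro closed_Collect_all closed_Collect_eq)
qed

text \<open>Expanding the square bounds \<open>(norm (\<xi> - t *\<^sub>R h \<xi>))\<^sup>2\<close>
  by \<open>1 - 2 * t * c + t\<^sup>2 * N\<^sup>2\<close> times \<open>(norm \<xi>)\<^sup>2\<close>
  whenever \<open>norm h \<le> N\<close>. This quadratic is least at
  \<open>t = c / N\<^sup>2\<close>, where its value is \<open>1 - (c / N)\<^sup>2\<close>.\<close>

lemma coercive_norm_id_diff:
  fixes h :: "'a::complex_inner \<Rightarrow>\<^sub>L 'a"
  assumes c: "c > 0" and h: "\<And>\<xi>. c * (norm \<xi>)\<^sup>2 \<le> Re (cinner (h \<xi>) \<xi>)"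
  obtains t where "t > 0" "norm (id_blinfun - t *\<^sub>R h) < 1"
proof
  \<comment> \<open>The summand \<open>c\<close> keeps \<open>N\<close> positive and
    \<open>c / N\<close> at most 1 even on the zero space, where \<open>norm h = 0\<close>; hence
    \<open>q\<close> below is the root of a nonnegative number.\<close>
  define N where "N = norm h + c"
  have N: "N > 0" "c \<le> N" "norm h \<le> N" using c by (auto simp: N_def add_nonneg_pos)
  define t where "t = c / N\<^sup>2"
  show t: "t > 0" using c N by (simp add: t_def)
  define q where "q = sqrt (1 - (c / N)\<^sup>2)"
  have cN: "0 < (c / N)\<^sup>2" "(c / N)\<^sup>2 \<le> 1"
    using c N by (auto simp: abs_square_le_1)
  have "norm (id_blinfun - t *\<^sub>R h) \<le> q"
  proof (rule norm_blinfun_bound)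
    show "0 \<le> q" using cN by (simp add: q_def)
    fix \<xi>
    have "(norm (\<xi> - t *\<^sub>R h \<xi>))\<^sup>2
        = (norm \<xi>)\<^sup>2 - 2 * t * Re (cinner (h \<xi>) \<xi>) + t\<^sup>2 * (norm (h \<xi>))\<^sup>2"
    proof -
      have "Re (cinner \<xi> (- (t *\<^sub>R h \<xi>))) = - t * Re (cinner (h \<xi>) \<xi>)"
        using cinner_scaleR_right[of \<xi> "- t" "h \<xi>"] cinner_commute[of \<xi> "h \<xi>"] by simp
      then show ?thesis
        using norm_add_sq[of \<xi> "- (t *\<^sub>R h \<xi>)"] by (simp add: power_mult_distrib)
    qed
    also have "\<dots> \<le> (norm \<xi>)\<^sup>2 - 2 * t * (c * (norm \<xi>)\<^sup>2) + t\<^sup>2 * (N * norm \<xi>)\<^sup>2"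
    proof -
      have "norm (h \<xi>) \<le> N * norm \<xi>"
        using norm_blinfun[of h \<xi>] N(3) by (meson mult_right_mono norm_ge_zero order_trans)
      then have "t\<^sup>2 * (norm (h \<xi>))\<^sup>2 \<le> t\<^sup>2 * (N * norm \<xi>)\<^sup>2"
        by (intro mult_left_mono power_mono) auto
      moreover have "2 * t * (c * (norm \<xi>)\<^sup>2) \<le> 2 * t * Re (cinner (h \<xi>) \<xi>)"
        using t h[of \<xi>] by (intro mult_left_mono) auto
      ultimately show ?thesis by linarith
    qed
    also have "\<dots> = (1 - (c / N)\<^sup>2) * (norm \<xi>)\<^sup>2"
      using N by (simp add: t_def power2_eq_square field_simps)
    also have "\<dots> = (q * norm \<xi>)\<^sup>2"
      using cN by (simp add: q_def power_mult_distrib)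
    finally have "norm (\<xi> - t *\<^sub>R h \<xi>) \<le> q * norm \<xi>"
      by (rule power2_le_imp_le) (use \<open>0 \<le> q\<close> in simp)
    then show "norm ((id_blinfun - t *\<^sub>R h) \<xi>) \<le> q * norm \<xi>"
      by (simp add: blinfun.bilinear_simps)
  qed
  also have "q < 1" using cN by (simp add: q_def)
  finally show "norm (id_blinfun - t *\<^sub>R h) < 1" .
qed

lemma norm_unitary:
  fixes u :: "'a::chilbert_space \<Rightarrow>\<^sub>L 'a"
  assumes "u \<in> complex_ops" "unitary_op u"
  shows "norm (u \<xi>) = norm \<xi>"
proof -
  have "cinner (u \<xi>) (u \<xi>) = cinner \<xi> ((adj u o\<^sub>L u) \<xi>)"
    using is_adjoint_adj[OF assms(1)] by (simp add: is_adjoint_def)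
  then have "complex_of_real ((norm (u \<xi>))\<^sup>2) = complex_of_real ((norm \<xi>)\<^sup>2)"
    using assms(2) by (simp only: cinner_self unitary_op_def id_blinfun.rep_eq id_apply)
  then have "(norm (u \<xi>))\<^sup>2 = (norm \<xi>)\<^sup>2"
    using of_real_eq_iff by blast
  then show ?thesis
    by (simp add: power2_eq_iff_nonneg)
qed

lemma norm_unitary_le_1:
  fixes u :: "'a::chilbert_space \<Rightarrow>\<^sub>L 'a"
  assumes "u \<in> complex_ops" "unitary_op u"
  shows "norm u \<le> 1"
  by (rule norm_blinfun_bound) (simp_all add: norm_unitary[OF assms])

text \<open>Preservation of inner products makes \<open>adj u\<close> a left inverse of
  \<open>u\<close>, and a left inverse must agree with the right inverse \<open>q\<close>.\<close>

lemma unitaryI: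
  fixes u :: "'a::chilbert_space \<Rightarrow>\<^sub>L 'a"
  assumes u: "u \<in> complex_ops" and iso: "\<And>\<xi> \<eta>. cinner (u \<xi>) (u \<eta>) = cinner \<xi> \<eta>"
    and q: "u o\<^sub>L q = id_blinfun"
  shows "unitary_op u"
proof -
  have 1: "adj u o\<^sub>L u = id_blinfun"
    using is_adjoint_adj[OF u] iso unfolding is_adjoint_def
    by (intro blinfun_eqI cinner_right_eqI) (metis blinfun_apply_blinfun_compose id_blinfun.rep_eq id_apply)
  have "adj u = adj u o\<^sub>L (u o\<^sub>L q)" by (simp add: q)
  also have "\<dots> = (adj u o\<^sub>L u) o\<^sub>L q" by (simp add: blinfun_compose_assoc)
  finally have "adj u = q" by (simp add: 1)
  with 1 q show ?thesis by (simp add: unitary_op_def)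
qed

text \<open>Pythagoras: \<open>cinner (s \<xi>) \<xi>\<close> is real, so its product with an
  imaginary scalar contributes nothing to the real part, and the cross term vanishes.\<close>

lemma norm_selfadjoint_add_imaginary:
  fixes s :: "'a::complex_inner \<Rightarrow>\<^sub>L 'a"
  assumes "is_adjoint s s"
  shows "(norm (s + scaleC_op (\<i> * of_real t) id_blinfun))\<^sup>2 \<le> (norm s)\<^sup>2 + t\<^sup>2"
proof -
  have "norm (s + scaleC_op (\<i> * of_real t) id_blinfun) \<le> sqrt ((norm s)\<^sup>2 + t\<^sup>2)"
  proof (rule norm_blinfun_bound)
    fix \<xi>
    have "cinner (s \<xi>) \<xi> = cnj (cinner (s \<xi>) \<xi>)"
      using assms cinner_commute[of \<xi> "s \<xi>"] by (simp add: is_adjoint_def)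
    then have "Im (cinner (s \<xi>) \<xi>) = 0"
      by (simp add: complex_eq_iff)
    then have "(norm (s \<xi> + (\<i> * of_real t) *\<^sub>C \<xi>))\<^sup>2 = (norm (s \<xi>))\<^sup>2 + t\<^sup>2 * (norm \<xi>)\<^sup>2"
      by (simp add: norm_add_sq cinner_scaleC_right norm_scaleC norm_mult power_mult_distrib)
    also have "\<dots> \<le> (norm s * norm \<xi>)\<^sup>2 + t\<^sup>2 * (norm \<xi>)\<^sup>2"
      by (intro add_right_mono power_mono norm_blinfun) simp
    also have "\<dots> = (sqrt ((norm s)\<^sup>2 + t\<^sup>2) * norm \<xi>)\<^sup>2"
      by (simp add: power_mult_distrib distrib_right)
    finally have "norm (s \<xi> + (\<i> * of_real t) *\<^sub>C \<xi>) \<le> sqrt ((norm s)\<^sup>2 + t\<^sup>2) * norm \<xi>"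
      by (rule power2_le_imp_le) simp
    then show "norm ((s + scaleC_op (\<i> * of_real t) id_blinfun) \<xi>) \<le> sqrt ((norm s)\<^sup>2 + t\<^sup>2) * norm \<xi>"
      by (simp add: blinfun.add_left scaleC_op.rep_eq)
  qed simp
  then show ?thesis
    using power_mono[OF _ norm_ge_zero, of _ "sqrt ((norm s)\<^sup>2 + t\<^sup>2)" 2] by simp
qed

section \<open>The ultraweak topology compared with the norm topology\<close>

text \<open>By Cauchy-Schwarz each term is at most \<open>norm T\<close> times
  \<open>norm (\<xi> n) * norm (\<eta> n)\<close>, and these products are summable because they are
  dominated by the sum of the two squares.\<close>

lemma bounded_linear_ultraweak_functional:
  fixes \<xi> \<eta> :: "nat \<Rightarrow> 'a::chilbert_space"
  assumes "summable (\<lambda>n. (norm (\<xi> n))\<^sup>2)" "summable (\<lambda>n. (norm (\<eta> n))\<^sup>2)"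
  shows "bounded_linear (\<lambda>T::'a \<Rightarrow>\<^sub>L 'a. \<Sum>n. cinner (T (\<xi> n)) (\<eta> n))"
proof (rule bounded_linear_intro[where K = "\<Sum>n. norm (\<xi> n) * norm (\<eta> n)"])
  have sm: "summable (\<lambda>n. norm (\<xi> n) * norm (\<eta> n))"
  proof (rule summable_comparison_test')
    show "summable (\<lambda>n. (norm (\<xi> n))\<^sup>2 + (norm (\<eta> n))\<^sup>2)"
      using assms by (rule summable_add)
    show "norm (norm (\<xi> n) * norm (\<eta> n)) \<le> (norm (\<xi> n))\<^sup>2 + (norm (\<eta> n))\<^sup>2" for n
      using sum_squares_bound[of "norm (\<xi> n)" "norm (\<eta> n)"]
        mult_nonneg_nonneg[OF norm_ge_zero[of "\<xi> n"] norm_ge_zero[of "\<eta> n"]]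
      unfolding real_norm_def abs_mult abs_norm_cancel mult.assoc by linarith
  qed
  have le: "norm (cinner (T (\<xi> n)) (\<eta> n)) \<le> norm T * (norm (\<xi> n) * norm (\<eta> n))"
    for T :: "'a \<Rightarrow>\<^sub>L 'a" and n
  proof -
    have "cmod (cinner (T (\<xi> n)) (\<eta> n)) \<le> norm (T (\<xi> n)) * norm (\<eta> n)" by (rule cmod_cinner_le)
    also have "\<dots> \<le> (norm T * norm (\<xi> n)) * norm (\<eta> n)"
      by (intro mult_right_mono norm_blinfun) simp
    finally show ?thesis by (simp add: mult.assoc)
  qed
  have sT: "summable (\<lambda>n. cinner (T (\<xi> n)) (\<eta> n))" for T :: "'a \<Rightarrow>\<^sub>L 'a"
    by (rule summable_comparison_test'[OF summable_mult[OF sm, of "norm T"] le])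
  fix S T :: "'a \<Rightarrow>\<^sub>L 'a" and r :: real
  show "(\<Sum>n. cinner ((S + T) (\<xi> n)) (\<eta> n))
      = (\<Sum>n. cinner (S (\<xi> n)) (\<eta> n)) + (\<Sum>n. cinner (T (\<xi> n)) (\<eta> n))"
    by (simp add: blinfun.add_left cinner_add_left suminf_add sT)
  show "(\<Sum>n. cinner ((r *\<^sub>R T) (\<xi> n)) (\<eta> n)) = r *\<^sub>R (\<Sum>n. cinner (T (\<xi> n)) (\<eta> n))"
    by (simp add: blinfun.scaleR_left cinner_scaleR_left scaleR_conv_of_real suminf_mult sT)
  have "norm (\<Sum>n. cinner (T (\<xi> n)) (\<eta> n)) \<le> (\<Sum>n. norm T * (norm (\<xi> n) * norm (\<eta> n)))"
    by (rule norm_suminf_le[OF le summable_mult[OF sm]])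
  then show "norm (\<Sum>n. cinner (T (\<xi> n)) (\<eta> n)) \<le> norm T * (\<Sum>n. norm (\<xi> n) * norm (\<eta> n))"
    by (simp add: suminf_mult sm)
qed

text \<open>Every generating set is the preimage of an open set under a norm-continuous functional.
  This is what makes normal functionals norm-continuous, and hence bounded.\<close>

lemma ultraweak_topology_weaker_than_euclidean:
  "continuous_map euclidean ultraweak_topology (\<lambda>T::'a::chilbert_space \<Rightarrow>\<^sub>L 'a. T)"
  unfolding ultraweak_topology_def
proof (rule continuous_on_generated_topo)
  fix V :: "('a \<Rightarrow>\<^sub>L 'a) set"
  assume "V \<in> {{T. (\<Sum>n. cinner (blinfun_apply T (\<xi> n)) (\<eta> n)) \<in> U} |\<xi> \<eta> U.
        summable (\<lambda>n::nat. (norm (\<xi> n))\<^sup>2) \<and> summable (\<lambda>n. (norm (\<eta> n))\<^sup>2) \<and> open U}"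
  then obtain \<xi> \<eta> :: "nat \<Rightarrow> 'a" and U where
    V: "V = (\<lambda>T. \<Sum>n. cinner (blinfun_apply T (\<xi> n)) (\<eta> n)) -` U"
    and sm: "summable (\<lambda>n. (norm (\<xi> n))\<^sup>2)" "summable (\<lambda>n. (norm (\<eta> n))\<^sup>2)" and "open U"
    unfolding vimage_def by blast
  have "open V"
    unfolding V
    by (intro open_vimage \<open>open U\<close> linear_continuous_on bounded_linear_ultraweak_functional sm)
  then show "openin euclidean ((\<lambda>T. T) -` V \<inter> topspace euclidean)" by simp
next
  \<comment> \<open>Zero sequences with \<open>U = UNIV\<close> already give the whole space, so the
    generators cover it.\<close>
  have "UNIV \<in> {{T::'a \<Rightarrow>\<^sub>L 'a. (\<Sum>n. cinner (blinfun_apply T (\<xi> n)) (\<eta> n)) \<in> U} |\<xi> \<eta> U.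
        summable (\<lambda>n::nat. (norm (\<xi> n))\<^sup>2) \<and> summable (\<lambda>n. (norm (\<eta> n))\<^sup>2) \<and> open U}"
    by (rule CollectI, rule exI[of _ "\<lambda>_. 0"], rule exI[of _ "\<lambda>_. 0"], rule exI[of _ UNIV]) auto
  then show "(\<lambda>T. T) ` topspace euclidean \<subseteq> \<Union> {{T::'a \<Rightarrow>\<^sub>L 'a.
        (\<Sum>n. cinner (blinfun_apply T (\<xi> n)) (\<eta> n)) \<in> U} |\<xi> \<eta> U.
        summable (\<lambda>n::nat. (norm (\<xi> n))\<^sup>2) \<and> summable (\<lambda>n. (norm (\<eta> n))\<^sup>2) \<and> open U}"
    by blast
qed

subsection \<open>Inverses and square roots in a von Neumann algebra\<close>

context
  fixes M :: "('a::chilbert_space \<Rightarrow>\<^sub>L 'a) set"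
  assumes M: "von_neumann_algebra M"
begin

lemma vna_complex_ops: "T \<in> M \<Longrightarrow> T \<in> complex_ops"
  and vna_id: "id_blinfun \<in> M"
  and vna_add: "S \<in> M \<Longrightarrow> T \<in> M \<Longrightarrow> S + T \<in> M"
  and vna_scaleC: "T \<in> M \<Longrightarrow> scaleC_op c T \<in> M"
  and vna_compose: "S \<in> M \<Longrightarrow> T \<in> M \<Longrightarrow> S o\<^sub>L T \<in> M"
  and vna_adj: "T \<in> M \<Longrightarrow> adj T \<in> M"
  using M by (auto simp: von_neumann_algebra_def)

lemma vna_scaleR: "T \<in> M \<Longrightarrow> r *\<^sub>R T \<in> M"
  by (metis scaleC_op_of_real vna_scaleC)

lemma vna_diff: "S \<in> M \<Longrightarrow> T \<in> M \<Longrightarrow> S - T \<in> M"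
  using vna_add[of S "(-1) *\<^sub>R T"] vna_scaleR[of T "-1"] by simp

lemma vna_zero: "0 \<in> M"
  using vna_diff[OF vna_id vna_id] by simp

text \<open>The strong operator topology is weaker than the norm topology. Norm-closedness gives the
  completeness that the fixed-point arguments in \<open>M\<close> require.\<close>

lemma vna_closed: "closed M"
proof -
  have "closedin strong_operator_topology M"
    using M by (simp add: von_neumann_algebra_def)
  from closedin_continuous_map_preimage[OF strong_operator_topology_weaker_than_euclidean this]
  show ?thesis by simp
qed

text \<open>Fixed points replace the Neumann series: \<open>w = 1 + y w\<close> yields a right
  inverse in \<open>M\<close> and \<open>v = 1 + v y\<close> a left inverse; both maps contract with
  constant \<open>norm y\<close>. The two inverses then coincide.\<close>

lemma invertible_id_diff:
  assumes y: "y \<in> M" "norm y < 1"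
  shows "invertible_in M (id_blinfun - y)"
proof -
  have cM: "complete M" using vna_closed by (simp add: complete_eq_closed)
  have "\<exists>!w. w \<in> M \<and> id_blinfun + (y o\<^sub>L w) = w"
  proof (rule Banach_fix[OF cM, of "norm y"])
    show "dist (id_blinfun + (y o\<^sub>L v)) (id_blinfun + (y o\<^sub>L w)) \<le> norm y * dist v w" for v w
      using norm_blinfun_compose[of y "v - w"] by (simp add: dist_norm compose_simps)
  qed (use y vna_zero in \<open>auto intro!: vna_add vna_id vna_compose\<close>)
  then obtain w where w: "w \<in> M" "id_blinfun + (y o\<^sub>L w) = w" by blast
  have "\<exists>!w. w \<in> M \<and> id_blinfun + (w o\<^sub>L y) = w"
  proof (rule Banach_fix[OF cM, of "norm y"])
    show "dist (id_blinfun + (v o\<^sub>L y)) (id_blinfun + (w o\<^sub>L y)) \<le> norm y * dist v w" for v w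
      using norm_blinfun_compose[of "v - w" y] by (simp add: dist_norm compose_simps mult.commute)
  qed (use y vna_zero in \<open>auto intro!: vna_add vna_id vna_compose\<close>)
  then obtain v where v: "v \<in> M" "id_blinfun + (v o\<^sub>L y) = v" by blast
  have 1: "(id_blinfun - y) o\<^sub>L w = id_blinfun"
    using w(2) by (simp add: compose_simps algebra_simps)
  have 2: "v o\<^sub>L (id_blinfun - y) = id_blinfun"
    using v(2) by (simp add: compose_simps algebra_simps)
  have "v = v o\<^sub>L ((id_blinfun - y) o\<^sub>L w)" by (simp add: 1)
  also have "\<dots> = (v o\<^sub>L (id_blinfun - y)) o\<^sub>L w" by (simp add: blinfun_compose_assoc)
  finally have "v = w" by (simp add: 2)
  with 1 2 w(1) show ?thesis unfolding invertible_in_def by blast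
qed

text \<open>The equation \<open>(1 - z)\<^sup>2 = 1 - y\<close> is equivalent to
  \<open>z = (y + z\<^sup>2) / 2\<close>. On the self-adjoint part of the ball of radius
  \<open>norm y\<close> in \<open>M\<close> the right-hand side is a self-map, and it contracts with
  constant \<open>norm y\<close>.\<close>

lemma sqrt_id_diff:
  assumes y: "y \<in> M" "is_adjoint y y" "norm y < 1"
  obtains z where "z \<in> M" "is_adjoint z z" "norm z < 1"
    "(id_blinfun - z) o\<^sub>L (id_blinfun - z) = id_blinfun - y"
proof -
  define S where "S = M \<inter> {z. is_adjoint z z} \<inter> cball 0 (norm y)"
  define F where "F z = (1/2) *\<^sub>R (y + (z o\<^sub>L z))" for z
  have "\<exists>!z. z \<in> S \<and> F z = z"
  proof (rule Banach_fix[of S "norm y"])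
    have "closed S"
      unfolding S_def by (intro closed_Int vna_closed closed_selfadjoint closed_cball)
    then show "complete S" by (simp add: complete_eq_closed)
    show "S \<noteq> {}" using y by (auto simp: S_def)
    show "F ` S \<subseteq> S"
    proof safe
      fix z assume "z \<in> S"
      then have z: "z \<in> M" "is_adjoint z z" "norm z \<le> norm y" by (auto simp: S_def)
      have "F z \<in> M" unfolding F_def by (intro vna_scaleR vna_add vna_compose z y)
      moreover have "is_adjoint (F z) (F z)"
        using z(2) y(2) unfolding is_adjoint_def F_def
        by (simp add: blinfun.bilinear_simps cinner_scaleR_left cinner_scaleR_right
            cinner_add_left cinner_add_right)
      moreover have "norm (F z) \<le> norm y"
      proof -
        have "norm (z o\<^sub>L z) \<le> norm z * norm z" by (rule norm_blinfun_compose)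
        also have "\<dots> \<le> norm y * 1" using z y by (intro mult_mono) auto
        finally show ?thesis
          using norm_triangle_ineq[of y "z o\<^sub>L z"] by (simp add: F_def)
      qed
      ultimately show "F z \<in> S" by (simp add: S_def)
    qed
    fix v w assume "v \<in> S" "w \<in> S"
    then have vw: "norm v \<le> norm y" "norm w \<le> norm y" by (auto simp: S_def)
    \<comment> \<open>The difference of squares is split so that \<open>v\<close> and
      \<open>w\<close> are not assumed to commute.\<close>
    have "F v - F w = (1/2) *\<^sub>R ((v o\<^sub>L (v - w)) + ((v - w) o\<^sub>L w))"
      by (simp add: F_def compose_simps flip: scaleR_diff_right)
    also have "norm \<dots> \<le> (1/2) * (norm v * norm (v - w) + norm (v - w) * norm w)"
      using norm_triangle_ineq[of "v o\<^sub>L (v - w)" "(v - w) o\<^sub>L w"]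
        norm_blinfun_compose[of v "v - w"] norm_blinfun_compose[of "v - w" w] by simp
    also have "\<dots> \<le> (1/2) * (norm y * norm (v - w) + norm (v - w) * norm y)"
      using vw by (intro mult_left_mono add_mono mult_right_mono) auto
    finally show "dist (F v) (F w) \<le> norm y * dist v w"
      by (simp add: dist_norm mult.commute)
  qed (use y in auto)
  then obtain z where z: "z \<in> M" "is_adjoint z z" "norm z \<le> norm y" "F z = z"
    by (auto simp: S_def)
  have "2 *\<^sub>R F z = y + (z o\<^sub>L z)" by (simp add: F_def)
  with z(4) have "2 *\<^sub>R z = y + (z o\<^sub>L z)" by simp
  then have "(id_blinfun - z) o\<^sub>L (id_blinfun - z) = id_blinfun - y"
    by (simp add: compose_simps algebra_simps scaleR_2)
  with z y show ?thesis by (intro that) auto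
qed

lemma invertible_compose:
  assumes "invertible_in M S" "invertible_in M T"
  shows "invertible_in M (S o\<^sub>L T)"
proof -
  obtain S' T' where *: "S' \<in> M" "S o\<^sub>L S' = id_blinfun" "S' o\<^sub>L S = id_blinfun"
    "T' \<in> M" "T o\<^sub>L T' = id_blinfun" "T' o\<^sub>L T = id_blinfun"
    using assms unfolding invertible_in_def by blast
  have "(S o\<^sub>L T) o\<^sub>L (T' o\<^sub>L S') = S o\<^sub>L (T o\<^sub>L T') o\<^sub>L S'"
    "(T' o\<^sub>L S') o\<^sub>L (S o\<^sub>L T) = T' o\<^sub>L (S' o\<^sub>L S) o\<^sub>L T"
    by (simp_all add: blinfun_compose_assoc)
  with * show ?thesis
    unfolding invertible_in_def by (intro bexI[of _ "T' o\<^sub>L S'"]) (auto intro: vna_compose)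
qed

lemma invertible_scaleR:
  assumes "invertible_in M T" "r \<noteq> 0"
  shows "invertible_in M (r *\<^sub>R T)"
proof -
  obtain T' where "T' \<in> M" "T o\<^sub>L T' = id_blinfun" "T' o\<^sub>L T = id_blinfun"
    using assms unfolding invertible_in_def by blast
  with assms(2) show ?thesis
    unfolding invertible_in_def
    by (intro bexI[of _ "(1 / r) *\<^sub>R T'"]) (auto simp: compose_simps intro: vna_scaleR)
qed

text \<open>Write \<open>t *\<^sub>R h\<close> as the identity minus an element of norm below 1,
  then remove the factor \<open>t\<close>.\<close>

lemma coercive_invertible:
  assumes "h \<in> M" "c > 0" "\<And>\<xi>. c * (norm \<xi>)\<^sup>2 \<le> Re (cinner (h \<xi>) \<xi>)"
  shows "invertible_in M h"
proof -
  obtain t where t: "t > 0" "norm (id_blinfun - t *\<^sub>R h) < 1"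
    using coercive_norm_id_diff assms(2,3) by blast
  have "invertible_in M (id_blinfun - (id_blinfun - t *\<^sub>R h))"
    by (intro invertible_id_diff vna_diff vna_id vna_scaleR assms t)
  then have "invertible_in M ((1 / t) *\<^sub>R (t *\<^sub>R h))"
    using t by (intro invertible_scaleR[of "t *\<^sub>R h"]) auto
  then show ?thesis using t by simp
qed

text \<open>The polar decomposition: \<open>|x|\<close> is \<open>1 - z\<close> up to the factor \<open>r\<close>.\<close>

lemma polar_decomposition:
  assumes x: "x \<in> M" "invertible_in M x"
  obtains u z r where "u \<in> M" "unitary_op u" "z \<in> M" "is_adjoint z z" "norm z < 1" "r > 0"
    "x = r *\<^sub>R (u o\<^sub>L (id_blinfun - z))"
proof -
  obtain v where v: "v o\<^sub>L x = id_blinfun"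
    using x(2) by (auto simp: invertible_in_def)
  \<comment> \<open>This is the square of the absolute value of \<open>x\<close>.\<close>
  define a where "a = adj x o\<^sub>L x"
  have aM: "a \<in> M" unfolding a_def by (intro vna_compose vna_adj x)
  have cinner_a: "cinner \<xi> (a \<eta>) = cinner (x \<xi>) (x \<eta>)" for \<xi> \<eta>
    using is_adjoint_adj[OF vna_complex_ops[OF x(1)]] by (simp add: a_def is_adjoint_def)
  then have a_adj: "is_adjoint a a"
    unfolding is_adjoint_def by (metis cinner_commute)
  \<comment> \<open>The left inverse \<open>v\<close> bounds \<open>x\<close> from below, which
    makes \<open>a\<close> coercive. Adding 1 avoids division by zero when
    \<open>norm v = 0\<close>.\<close>
  define c where "c = 1 / (norm v + 1)\<^sup>2"
  have nv: "norm v + 1 > 0" by (simp add: add_nonneg_pos)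
  then have "c > 0" by (simp add: c_def)
  moreover have "c * (norm \<xi>)\<^sup>2 \<le> Re (cinner (a \<xi>) \<xi>)" for \<xi>
  proof -
    have "norm \<xi> = norm (v (x \<xi>))"
      by (metis v blinfun_apply_blinfun_compose blinfun_apply_id_blinfun id_apply)
    also have "\<dots> \<le> norm v * norm (x \<xi>)" by (rule norm_blinfun)
    also have "\<dots> \<le> (norm v + 1) * norm (x \<xi>)" by (intro mult_right_mono) auto
    finally have "(norm \<xi>)\<^sup>2 \<le> ((norm v + 1) * norm (x \<xi>))\<^sup>2" by (intro power_mono) auto
    then have "c * (norm \<xi>)\<^sup>2 \<le> (norm (x \<xi>))\<^sup>2"
      using nv by (simp add: c_def power_mult_distrib divide_le_eq mult.commute)
    moreover have "cinner (a \<xi>) \<xi> = complex_of_real ((norm (x \<xi>))\<^sup>2)"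
      using a_adj cinner_a[of \<xi> \<xi>] cinner_self[of "x \<xi>"] by (simp add: is_adjoint_def)
    ultimately show ?thesis by (metis Re_complex_of_real)
  qed
  ultimately obtain t where t: "t > 0" "norm (id_blinfun - t *\<^sub>R a) < 1"
    using coercive_norm_id_diff by blast
  define y where "y = id_blinfun - t *\<^sub>R a"
  have "y \<in> M" unfolding y_def by (intro vna_diff vna_id vna_scaleR aM)
  moreover have "is_adjoint y y"
    using a_adj by (simp add: y_def is_adjoint_def blinfun.bilinear_simps cinner_diff_left
        cinner_diff_right cinner_scaleR_left cinner_scaleR_right)
  ultimately obtain z where z: "z \<in> M" "is_adjoint z z" "norm z < 1"
    and zy: "(id_blinfun - z) o\<^sub>L (id_blinfun - z) = id_blinfun - y"
    using sqrt_id_diff t(2) unfolding y_def by metis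
  \<comment> \<open>Since \<open>s\<close> squares to \<open>t *\<^sub>R a\<close> and
    \<open>norm z < 1\<close>, it is \<open>sqrt t\<close> times the absolute value of
    \<open>x\<close>.\<close>
  define s where "s = id_blinfun - z"
  have ss: "s o\<^sub>L s = t *\<^sub>R a" using zy by (simp add: s_def y_def)
  have s_adj: "cinner (s \<xi>) \<eta> = cinner \<xi> (s \<eta>)" for \<xi> \<eta>
    using z(2) by (simp add: s_def is_adjoint_def blinfun.bilinear_simps cinner_diff_left
        cinner_diff_right)
  obtain w where w: "w \<in> M" "s o\<^sub>L w = id_blinfun" "w o\<^sub>L s = id_blinfun"
    using invertible_id_diff z unfolding s_def invertible_in_def by blast
  have sM: "s \<in> M" unfolding s_def by (intro vna_diff vna_id z)
  \<comment> \<open>With \<open>w\<close> inverse to \<open>s\<close>, this is \<open>x\<close>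
    times the inverse of its absolute value, the unitary factor.\<close>
  define u where "u = sqrt t *\<^sub>R (x o\<^sub>L w)"
  have uM: "u \<in> M" unfolding u_def by (intro vna_scaleR vna_compose x w)
  have "invertible_in M w" using w sM by (auto simp: invertible_in_def)
  then have "invertible_in M u"
    unfolding u_def using t x by (intro invertible_scaleR invertible_compose) auto
  then obtain q where q: "u o\<^sub>L q = id_blinfun" by (auto simp: invertible_in_def)
  \<comment> \<open>Moving \<open>x\<close> across produces \<open>t *\<^sub>R a\<close>, which is
    \<open>s o\<^sub>L s\<close>; one factor \<open>s\<close> goes back to the left, and each
    cancels a \<open>w\<close>.\<close>
  have iso: "cinner (u \<xi>) (u \<eta>) = cinner \<xi> \<eta>" for \<xi> \<eta>
  proof -
    have "complex_of_real (sqrt t) * complex_of_real (sqrt t) = complex_of_real t"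
      using t by (simp flip: of_real_mult)
    then have "cinner (u \<xi>) (u \<eta>) = of_real t * cinner (x (w \<xi>)) (x (w \<eta>))"
      by (simp add: u_def blinfun.bilinear_simps cinner_scaleR_left cinner_scaleR_right
          flip: mult.assoc)
    also have "\<dots> = cinner (w \<xi>) ((t *\<^sub>R a) (w \<eta>))"
      by (simp add: blinfun.bilinear_simps cinner_scaleR_right cinner_a)
    also have "\<dots> = cinner ((s o\<^sub>L w) \<xi>) ((s o\<^sub>L w) \<eta>)"
      unfolding ss[symmetric] by (simp add: s_adj)
    finally show ?thesis by (simp add: w)
  qed
  have "u o\<^sub>L s = sqrt t *\<^sub>R x"
    by (simp add: u_def compose_simps blinfun_compose_assoc w)
  then have "x = (1 / sqrt t) *\<^sub>R (u o\<^sub>L (id_blinfun - z))"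
    using t by (simp add: s_def)
  moreover have "unitary_op u" using unitaryI[OF vna_complex_ops[OF uM] iso q] .
  ultimately show ?thesis
    using that[of u z "1 / sqrt t"] uM z t by simp
qed

subsection \<open>Normal functionals\<close>

lemma
  assumes "f \<in> predual M"
  shows predual_add: "S \<in> M \<Longrightarrow> T \<in> M \<Longrightarrow> f (S + T) = f S + f T"
    and predual_scaleC: "T \<in> M \<Longrightarrow> f (scaleC_op c T) = c * f T"
    and predual_scaleR: "T \<in> M \<Longrightarrow> f (r *\<^sub>R T) = of_real r * f T"
proof -
  show "T \<in> M \<Longrightarrow> f (scaleC_op c T) = c * f T" for c T
    using assms by (simp add: predual_def)
  then show "T \<in> M \<Longrightarrow> f (r *\<^sub>R T) = of_real r * f T"
    by (metis scaleC_op_of_real)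
qed (use assms in \<open>simp add: predual_def\<close>)

text \<open>Ultraweak continuity on \<open>M\<close> implies norm continuity there, and a linear
  functional continuous at 0 is bounded. Without such a bound the real supremum in
  \<open>functional_norm\<close> would not control the values of \<open>f\<close>.\<close>

lemma predual_bounded:
  assumes f: "f \<in> predual M"
  obtains K where "\<And>T. T \<in> M \<Longrightarrow> norm T \<le> 1 \<Longrightarrow> cmod (f T) \<le> K"
proof -
  have "continuous_map (subtopology ultraweak_topology M) euclidean f"
    using f by (simp add: predual_def)
  moreover have "continuous_map (subtopology euclidean M) (subtopology ultraweak_topology M) (\<lambda>T. T)"
    using ultraweak_topology_weaker_than_euclidean
    by (intro continuous_map_into_subtopology continuous_map_from_subtopology) auto
  ultimately have "continuous_map (subtopology euclidean M) euclidean (f \<circ> (\<lambda>T. T))"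
    by (rule continuous_map_compose[rotated])
  then have cont: "continuous_on M f" by (simp add: o_def)
  have "f 0 = 0" using predual_scaleR[OF f vna_zero, of 0] by simp
  with cont vna_zero obtain d where d: "d > 0" "\<And>T. T \<in> M \<Longrightarrow> norm T < d \<Longrightarrow> cmod (f T) < 1"
    unfolding continuous_on_iff by (metis dist_0_norm dist_commute zero_less_one)
  have "cmod (f T) \<le> 2 / d" if "T \<in> M" "norm T \<le> 1" for T
  proof -
    \<comment> \<open>Half of \<open>d\<close> keeps the rescaled operator strictly inside the ball
      given by continuity at 0.\<close>
    have "norm ((d/2) *\<^sub>R T) < d"
      using d(1) that(2) mult_left_mono[OF that(2), of "d/2"] by simp
    then have "cmod (f ((d/2) *\<^sub>R T)) < 1" by (intro d vna_scaleR that)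
    then show ?thesis
      using d(1) by (simp add: predual_scaleR[OF f that(1)] norm_mult field_simps)
  qed
  then show ?thesis by (rule that)
qed

text \<open>Boundedness makes the supremum a genuine upper bound, so
  \<open>functional_norm M f = 1\<close> controls \<open>f\<close> on the unit ball of
  \<open>M\<close>; homogeneity extends this to \<open>M\<close>.\<close>

lemma
  assumes f: "f \<in> normal_states_at M u"
  shows normal_state_at: "f u = 1"
    and normal_state_norm_le: "T \<in> M \<Longrightarrow> cmod (f T) \<le> norm T"
proof -
  have fp: "f \<in> predual M" and f1: "functional_norm M f = 1"
    using f by (auto simp: normal_states_at_def)
  show "f u = 1" using f by (simp add: normal_states_at_def)
  obtain K where "\<And>T. T \<in> M \<Longrightarrow> norm T \<le> 1 \<Longrightarrow> cmod (f T) \<le> K"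
    using predual_bounded[OF fp] by blast
  then have bdd: "bdd_above ((\<lambda>T. cmod (f T)) ` {T \<in> M. norm T \<le> 1})"
    by (intro bdd_aboveI[of _ K]) auto
  have ball: "cmod (f T) \<le> 1" if "T \<in> M" "norm T \<le> 1" for T
    using cSUP_upper[OF _ bdd, of T] that f1 by (simp add: functional_norm_def)
  assume T: "T \<in> M"
  show "cmod (f T) \<le> norm T"
  proof (cases "T = 0")
    case True
    then show ?thesis using predual_scaleR[OF fp T, of 0] by simp
  next
    case False
    have "cmod (f ((1 / norm T) *\<^sub>R T)) \<le> 1"
      using False by (intro ball vna_scaleR T) simp
    then show ?thesis
      using False by (simp add: predual_scaleR[OF fp T] norm_divide field_simps)
  qed
qed

text \<open>If \<open>f (u s)\<close> had imaginary part \<open>\<beta> \<noteq> 0\<close>, then \<open>(\<beta> + t)\<^sup>2 \<le> \<parallel>s + i t\<parallel>\<^sup>2 \<le> \<parallel>s\<parallel>\<^sup>2 + t\<^sup>2\<close> would fail for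
  a suitable real \<open>t\<close>.\<close>

lemma normal_state_selfadjoint_real:
  assumes f: "f \<in> normal_states_at M u" and u: "u \<in> M" "unitary_op u"
    and s: "s \<in> M" "is_adjoint s s"
  shows "f (u o\<^sub>L s) \<in> \<real>"
proof -
  have fp: "f \<in> predual M" using f by (simp add: normal_states_at_def)
  have bound: "(Im (f (u o\<^sub>L s)) + t)\<^sup>2 \<le> (norm s)\<^sup>2 + t\<^sup>2" for t :: real
  proof -
    let ?T = "s + scaleC_op (\<i> * of_real t) id_blinfun"
    \<comment> \<open>Since \<open>f u = 1\<close>, adding an imaginary multiple of the identity to
      \<open>s\<close> shifts only the imaginary part of \<open>f (u o\<^sub>L s)\<close>, by
      exactly \<open>t\<close>.\<close>
    have "u o\<^sub>L ?T = (u o\<^sub>L s) + scaleC_op (\<i> * of_real t) u"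
      using vna_complex_ops[OF u(1)]
      by (intro blinfun_eqI) (simp add: blinfun.bilinear_simps scaleC_op.rep_eq complex_ops_def)
    then have "f (u o\<^sub>L ?T) = f (u o\<^sub>L s) + \<i> * of_real t"
      using u s by (simp add: predual_add[OF fp] predual_scaleC[OF fp] vna_scaleC vna_compose
          normal_state_at[OF f])
    then have "\<bar>Im (f (u o\<^sub>L s)) + t\<bar> \<le> cmod (f (u o\<^sub>L ?T))"
      using abs_Im_le_cmod[of "f (u o\<^sub>L ?T)"] by simp
    also have "\<dots> \<le> norm (u o\<^sub>L ?T)"
      by (intro normal_state_norm_le[OF f] vna_compose vna_add vna_scaleC vna_id u s)
    also have "\<dots> \<le> norm u * norm ?T" by (rule norm_blinfun_compose)
    also have "\<dots> \<le> 1 * norm ?T"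
      by (intro mult_right_mono norm_unitary_le_1 vna_complex_ops u) simp
    finally have "(Im (f (u o\<^sub>L s)) + t)\<^sup>2 \<le> (norm ?T)\<^sup>2"
      by (intro power2_le_iff_abs_le[THEN iffD2]) auto
    also have "\<dots> \<le> (norm s)\<^sup>2 + t\<^sup>2"
      by (rule norm_selfadjoint_add_imaginary[OF s(2)])
    finally show ?thesis .
  qed
  define \<beta> where "\<beta> = Im (f (u o\<^sub>L s))"
  have "\<beta> = 0"
  proof (rule ccontr)
    assume "\<beta> \<noteq> 0"
    \<comment> \<open>The chosen \<open>t\<close> makes the cross term
      \<open>2 * \<beta> * t\<close> equal to \<open>(norm s)\<^sup>2 + 1\<close>, just above what
      \<open>bound\<close> allows.\<close>
    then have "2 * \<beta> * (((norm s)\<^sup>2 + 1) / (2 * \<beta>)) = (norm s)\<^sup>2 + 1" by simp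
    then have "(\<beta> + ((norm s)\<^sup>2 + 1) / (2 * \<beta>))\<^sup>2
        = \<beta>\<^sup>2 + ((norm s)\<^sup>2 + 1) + (((norm s)\<^sup>2 + 1) / (2 * \<beta>))\<^sup>2"
      by (simp only: power2_sum)
    then show False
      using bound[of "((norm s)\<^sup>2 + 1) / (2 * \<beta>)"] zero_le_power2[of \<beta>]
      unfolding \<beta>_def[symmetric] by linarith
  qed
  then show ?thesis by (simp add: \<beta>_def complex_is_Real_iff)
qed

text \<open>Cauchy-Schwarz bounds the functional by 1 on the unit ball, and the isometry
  \<open>u\<close> attains this bound. The restriction to \<open>M\<close> supplies the
  extensionality required by \<open>predual\<close>.\<close>

lemma vector_state_normal:
  assumes u: "u \<in> M" "unitary_op u" and \<xi>: "norm \<xi> = 1"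
  shows "restrict (\<lambda>T::'a \<Rightarrow>\<^sub>L 'a. cinner (T \<xi>) (u \<xi>)) M \<in> normal_states_at M u"
proof -
  define f where "f = restrict (\<lambda>T::'a \<Rightarrow>\<^sub>L 'a. cinner (T \<xi>) (u \<xi>)) M"
  have nu: "norm (u \<xi>) = 1"
    using norm_unitary[OF vna_complex_ops u(2)] u \<xi> by simp
  have fu: "f u = 1"
    using u by (simp add: f_def cinner_self nu)
  have le: "cmod (f T) \<le> 1" if "T \<in> M" "norm T \<le> 1" for T
    using that cmod_cinner_le[of "T \<xi>" "u \<xi>"] norm_blinfun[of T \<xi>] by (simp add: f_def nu \<xi>)
  have "functional_norm M f = 1"
    unfolding functional_norm_def
  proof (rule cSup_eq_maximum)
    have "u \<in> {T \<in> M. norm T \<le> 1}"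
      using u norm_unitary_le_1[OF vna_complex_ops] by simp
    then show "1 \<in> (\<lambda>T. cmod (f T)) ` {T \<in> M. norm T \<le> 1}"
      using fu by (intro image_eqI[of _ _ u]) auto
  qed (use le in auto)
  moreover have "f \<in> predual M"
  proof -
    have "continuous_map (ultraweak_topology :: ('a \<Rightarrow>\<^sub>L 'a) topology) euclidean
        (\<lambda>T::'a \<Rightarrow>\<^sub>L 'a. cinner (T \<xi>) (u \<xi>))"
      unfolding continuous_map_alt
    proof (intro conjI allI impI)
      fix U :: "complex set" assume "openin euclidean U"
      \<comment> \<open>A vector at index 0 followed by zeros turns the vector functional into a
        series of the kind that generates the ultraweak topology.\<close>
      define e where "e \<zeta> n = (if n = 0 then \<zeta> else 0)" for \<zeta> :: 'a and n :: nat
      have sm: "summable (\<lambda>n. (norm (e \<zeta> n))\<^sup>2)" for \<zeta>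
        by (rule summable_finite[of "{0}"]) (auto simp: e_def)
      have "(\<Sum>n. cinner (T (e \<xi> n)) (e (u \<xi>) n)) = cinner (T \<xi>) (u \<xi>)" for T :: "'a \<Rightarrow>\<^sub>L 'a"
        using cinner_diff_right[of "0::'a" 0 0]
        by (subst suminf_finite[of "{0}"]) (auto simp: e_def)
      then have "(\<lambda>T::'a \<Rightarrow>\<^sub>L 'a. cinner (T \<xi>) (u \<xi>)) -` U
          = {T::'a \<Rightarrow>\<^sub>L 'a. (\<Sum>n. cinner (T (e \<xi> n)) (e (u \<xi>) n)) \<in> U}"
        by auto
      then have "openin ultraweak_topology ((\<lambda>T::'a \<Rightarrow>\<^sub>L 'a. cinner (T \<xi>) (u \<xi>)) -` U)"
        unfolding ultraweak_topology_def using sm \<open>openin euclidean U\<close>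
        by (intro topology_generated_by_Basis CollectI exI[of _ "e \<xi>"] exI[of _ "e (u \<xi>)"] exI[of _ U])
          simp
      then show "openin ultraweak_topology
          ((\<lambda>T::'a \<Rightarrow>\<^sub>L 'a. cinner (T \<xi>) (u \<xi>)) -` U \<inter> topspace ultraweak_topology)"
        by auto
    qed auto
    then have "continuous_map (subtopology ultraweak_topology M) euclidean
        (\<lambda>T::'a \<Rightarrow>\<^sub>L 'a. cinner (T \<xi>) (u \<xi>))"
      by (rule continuous_map_from_subtopology)
    then have "continuous_map (subtopology ultraweak_topology M) euclidean f"
      by (rule continuous_map_eq) (simp add: f_def)
    then show ?thesis
      unfolding predual_def
      by (auto simp: f_def vna_add vna_scaleC blinfun.add_left cinner_add_left scaleC_op.rep_eq
          cinner_scaleC_left)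
  qed
  ultimately show ?thesis
    using fu unfolding f_def[symmetric] by (simp add: normal_states_at_def)
qed

section \<open>Invertibility and lower bounds on normal functionals\<close>

text \<open>With \<open>x = r u (1 - z)\<close> from the polar decomposition,
  \<open>f x = r (1 - f (u z))\<close>. Here \<open>f (u z)\<close> is real and at most
  \<open>norm z < 1\<close>, so \<open>\<epsilon> = r * (1 - norm z)\<close> works.\<close>

lemma invertible_imp_normal_states_ge:
  assumes x: "x \<in> M" "invertible_in M x"
  obtains u \<epsilon> where "u \<in> M" "unitary_op u" "\<epsilon> > 0"
    "\<And>f. f \<in> normal_states_at M u \<Longrightarrow> f x \<in> \<real> \<and> \<epsilon> \<le> Re (f x)"
proof -
  obtain u z r where u: "u \<in> M" "unitary_op u" and z: "z \<in> M" "is_adjoint z z" "norm z < 1"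
    and r: "r > 0" and xu: "x = r *\<^sub>R (u o\<^sub>L (id_blinfun - z))"
    using polar_decomposition[OF x] by blast
  have "f x \<in> \<real> \<and> r * (1 - norm z) \<le> Re (f x)" if f: "f \<in> normal_states_at M u" for f
  proof -
    have fp: "f \<in> predual M" using f by (simp add: normal_states_at_def)
    have uz: "u o\<^sub>L z \<in> M" by (intro vna_compose u z)
    have "f (u o\<^sub>L (id_blinfun - z)) = f (u + (-1) *\<^sub>R (u o\<^sub>L z))"
      by (simp add: compose_simps)
    also have "\<dots> = 1 - f (u o\<^sub>L z)"
      by (simp only: predual_add[OF fp u(1) vna_scaleR[OF uz]] predual_scaleR[OF fp uz]
          normal_state_at[OF f]) simp
    finally have fx: "f x = of_real r * (1 - f (u o\<^sub>L z))"
      unfolding xu using predual_scaleR[OF fp, of "u o\<^sub>L (id_blinfun - z)" r] u z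
      by (simp add: vna_compose vna_diff vna_id)
    have "f (u o\<^sub>L z) \<in> \<real>"
      by (rule normal_state_selfadjoint_real[OF f u z(1,2)])
    then have "f x \<in> \<real>" unfolding fx by auto
    moreover have "Re (f (u o\<^sub>L z)) \<le> norm z"
    proof -
      have "Re (f (u o\<^sub>L z)) \<le> cmod (f (u o\<^sub>L z))" by (rule complex_Re_le_cmod)
      also have "\<dots> \<le> norm (u o\<^sub>L z)" by (rule normal_state_norm_le[OF f uz])
      also have "\<dots> \<le> norm u * norm z" by (rule norm_blinfun_compose)
      also have "\<dots> \<le> 1 * norm z"
        by (intro mult_right_mono norm_unitary_le_1 vna_complex_ops u) simp
      finally show ?thesis by simp
    qed
    ultimately show ?thesis using r by (simp add: fx)
  qed
  moreover have "r * (1 - norm z) > 0" using r z by simp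
  ultimately show ?thesis using that u by blast
qed

text \<open>Vector functionals at \<open>u\<close> turn the hypothesis into coercivity of
  \<open>h = adj u o\<^sub>L x\<close>; then \<open>h\<close> is invertible, and so is
  \<open>x = u o\<^sub>L h\<close>.\<close>

lemma normal_states_ge_imp_invertible:
  assumes x: "x \<in> M" and u: "u \<in> M" "unitary_op u" and "\<epsilon> > 0"
    and ge: "\<And>f. f \<in> normal_states_at M u \<Longrightarrow> \<epsilon> \<le> Re (f x)"
  shows "invertible_in M x"
proof -
  define h where "h = adj u o\<^sub>L x"
  have adj_u: "cinner (u \<xi>) \<eta> = cinner \<xi> (adj u \<eta>)" for \<xi> \<eta>
    using is_adjoint_adj[OF vna_complex_ops[OF u(1)]] by (simp add: is_adjoint_def)
  have "invertible_in M h"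
  proof (rule coercive_invertible[OF _ \<open>\<epsilon> > 0\<close>])
    show "h \<in> M" unfolding h_def by (intro vna_compose vna_adj u x)
    fix \<xi> :: 'a
    show "\<epsilon> * (norm \<xi>)\<^sup>2 \<le> Re (cinner (h \<xi>) \<xi>)"
    proof (cases "\<xi> = 0")
      case True
      then show ?thesis by (simp add: cinner_self blinfun.zero_right)
    next
      case False
      \<comment> \<open>Vector functionals require a unit vector; both sides of the coercivity
        estimate scale by \<open>(norm \<xi>)\<^sup>2\<close>.\<close>
      define \<zeta> where "\<zeta> = (1 / norm \<xi>) *\<^sub>R \<xi>"
      have "norm \<zeta> = 1" using False by (simp add: \<zeta>_def)
      from ge[OF vector_state_normal[OF u this]] have "\<epsilon> \<le> Re (cinner (x \<zeta>) (u \<zeta>))"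
        using x by simp
      \<comment> \<open>\<open>adj_u\<close> handles \<open>u\<close> in the first argument;
        conjugate symmetry carries it over to the second.\<close>
      also have "cinner (x \<zeta>) (u \<zeta>) = cinner (h \<zeta>) \<zeta>"
        by (simp add: h_def) (metis adj_u cinner_commute)
      also have "\<dots> = complex_of_real (1 / (norm \<xi>)\<^sup>2) * cinner (h \<xi>) \<xi>"
        by (simp add: \<zeta>_def blinfun.bilinear_simps cinner_scaleR_left cinner_scaleR_right
            power2_eq_square)
      finally have "\<epsilon> \<le> 1 / (norm \<xi>)\<^sup>2 * Re (cinner (h \<xi>) \<xi>)"
        by (simp only: Re_complex_of_real Im_complex_of_real times_complex.sel mult_zero_left diff_zero)
      then show ?thesis using False by (simp add: field_simps)
    qed
  qed
  moreover have "invertible_in M u"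
    using u vna_adj unfolding invertible_in_def unitary_op_def by blast
  ultimately have "invertible_in M (u o\<^sub>L h)" by (intro invertible_compose)
  moreover have "u o\<^sub>L h = (u o\<^sub>L adj u) o\<^sub>L x" by (simp add: h_def blinfun_compose_assoc)
  ultimately show ?thesis using u(2) by (simp add: unitary_op_def)
qed

end

theorem theorem4:
  fixes M :: "('a::chilbert_space \<Rightarrow>\<^sub>L 'a) set" and x :: "'a \<Rightarrow>\<^sub>L 'a"
  assumes "von_neumann_algebra M" and "x \<in> M"
  shows "invertible_in M x \<longleftrightarrow>
    (\<exists>u\<in>M. unitary_op u \<and>
      (\<exists>\<epsilon>::real. \<epsilon> > 0 \<and> (\<forall>f\<in>normal_states_at M u. f x \<in> \<real> \<and> \<epsilon> \<le> Re (f x))))"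
proof
  assume "invertible_in M x"
  from invertible_imp_normal_states_ge[OF assms this]
  show "\<exists>u\<in>M. unitary_op u \<and>
      (\<exists>\<epsilon>::real. \<epsilon> > 0 \<and> (\<forall>f\<in>normal_states_at M u. f x \<in> \<real> \<and> \<epsilon> \<le> Re (f x)))"
    by metis
next
  assume "\<exists>u\<in>M. unitary_op u \<and>
      (\<exists>\<epsilon>::real. \<epsilon> > 0 \<and> (\<forall>f\<in>normal_states_at M u. f x \<in> \<real> \<and> \<epsilon> \<le> Re (f x)))"
  then show "invertible_in M x"
    using normal_states_ge_imp_invertible[OF assms] by metis
qed

end
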